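(* $\mathrm{SAT}(\aleph_0)$ implies $2^{<\mathfrak{c}}=\mathfrak{c}$.
   Context: All ultrafilters are nonprincipal. For a cardinal $\kappa$, $\mathrm{SAT}(\kappa)$ is the statement: there exists a nonprincipal ultrafilter $U$ over $\omega$ such that for every countable first-order language $L$ and every sequence $(\mathcal{A}_i)_{i\in\omega}$ of $L$-structures each of size $\le\kappa$, the ultraproduct $\prod_{i\in\omega}\mathcal{A}_i/U$ is saturated (i.e. $|M|$-saturated, $M$ the ultraproduct). $\mathfrak{c}=2^{\aleph_0}$ and $2^{<\mathfrak{c}}=\sup_{\kappa<\mathfrak{c}}2^\kappa$. *)

theory Defs
  imports Complex_Main "HOL-Library.Countable_Set" "HOL-Library.FuncSet"
begin

unbundle cardinal_syntax

text \<open>Constant symbols are function symbols of arity 0; equality is a logical symbol.\<close>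

record ('f, 'r) language =
  funs :: "'f set"
  rels :: "'r set"
  fun_arity :: "'f \<Rightarrow> nat"
  rel_arity :: "'r \<Rightarrow> nat"

definition countable_language :: "('f, 'r) language \<Rightarrow> bool" where
  "countable_language L \<longleftrightarrow> countable (funs L) \<and> countable (rels L)"

datatype 'f trm = Var nat | App 'f "'f trm list"

datatype ('f, 'r) fm =
    Equal "'f trm" "'f trm"
  | Rel 'r "'f trm list"
  | Neg "('f, 'r) fm"
  | Conj "('f, 'r) fm" "('f, 'r) fm"
  | Exi nat "('f, 'r) fm"

primrec wf_trm :: "('f, 'r) language \<Rightarrow> 'f trm \<Rightarrow> bool" where
  "wf_trm L (Var n) \<longleftrightarrow> True"
| "wf_trm L (App f ts) \<longleftrightarrow>
     f \<in> funs L \<and> length ts = fun_arity L f \<and> list_all (wf_trm L) ts"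

primrec wf_fm :: "('f, 'r) language \<Rightarrow> ('f, 'r) fm \<Rightarrow> bool" where
  "wf_fm L (Equal s t) \<longleftrightarrow> wf_trm L s \<and> wf_trm L t"
| "wf_fm L (Rel r ts) \<longleftrightarrow>
     r \<in> rels L \<and> length ts = rel_arity L r \<and> list_all (wf_trm L) ts"
| "wf_fm L (Neg \<phi>) \<longleftrightarrow> wf_fm L \<phi>"
| "wf_fm L (Conj \<phi> \<psi>) \<longleftrightarrow> wf_fm L \<phi> \<and> wf_fm L \<psi>"
| "wf_fm L (Exi n \<phi>) \<longleftrightarrow> wf_fm L \<phi>"

primrec fv_trm :: "'f trm \<Rightarrow> nat set" where
  "fv_trm (Var n) = {n}"
| "fv_trm (App f ts) = \<Union> (set (map fv_trm ts))"

primrec fv :: "('f, 'r) fm \<Rightarrow> nat set" where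
  "fv (Equal s t) = fv_trm s \<union> fv_trm t"
| "fv (Rel r ts) = \<Union> (set (map fv_trm ts))"
| "fv (Neg \<phi>) = fv \<phi>"
| "fv (Conj \<phi> \<psi>) = fv \<phi> \<union> fv \<psi>"
| "fv (Exi n \<phi>) = fv \<phi> - {n}"

record ('f, 'r, 'a) struct =
  univ :: "'a set"
  fun_int :: "'f \<Rightarrow> 'a list \<Rightarrow> 'a"
  rel_int :: "'r \<Rightarrow> 'a list \<Rightarrow> bool"

definition is_structure :: "('f, 'r) language \<Rightarrow> ('f, 'r, 'a) struct \<Rightarrow> bool" where
  "is_structure L M \<longleftrightarrow> univ M \<noteq> {} \<and>
     (\<forall>f\<in>funs L. \<forall>xs. set xs \<subseteq> univ M \<and> length xs = fun_arity L f \<longrightarrow> fun_int M f xs \<in> univ M)"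

primrec eval :: "('f, 'r, 'a) struct \<Rightarrow> (nat \<Rightarrow> 'a) \<Rightarrow> 'f trm \<Rightarrow> 'a" where
  "eval M e (Var n) = e n"
| "eval M e (App f ts) = fun_int M f (map (eval M e) ts)"

primrec sat :: "('f, 'r, 'a) struct \<Rightarrow> (nat \<Rightarrow> 'a) \<Rightarrow> ('f, 'r) fm \<Rightarrow> bool" where
  "sat M e (Equal s t) \<longleftrightarrow> eval M e s = eval M e t"
| "sat M e (Rel r ts) \<longleftrightarrow> rel_int M r (map (eval M e) ts)"
| "sat M e (Neg \<phi>) \<longleftrightarrow> \<not> sat M e \<phi>"
| "sat M e (Conj \<phi> \<psi>) \<longleftrightarrow> sat M e \<phi> \<and> sat M e \<psi>"
| "sat M e (Exi n \<phi>) \<longleftrightarrow> (\<exists>a\<in>univ M. sat M (e(n := a)) \<phi>)"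

text \<open>The language \<open>L\<^sub>A\<close>, with a new constant symbol \<open>Inr a\<close> for every \<open>a \<in> A\<close>, and the
  corresponding expansion of a structure.\<close>

definition add_constants :: "('f, 'r) language \<Rightarrow> 'a set \<Rightarrow> ('f + 'a, 'r) language" where
  "add_constants L A =
     \<lparr>funs = Inl ` funs L \<union> Inr ` A, rels = rels L,
      fun_arity = case_sum (fun_arity L) (\<lambda>_. 0), rel_arity = rel_arity L\<rparr>"

definition name_elements :: "('f, 'r, 'a) struct \<Rightarrow> ('f + 'a, 'r, 'a) struct" where
  "name_elements M =
     \<lparr>univ = univ M, fun_int = case_sum (fun_int M) (\<lambda>a _. a), rel_int = rel_int M\<rparr>"

text \<open>Only variable 0 may occur free in the formulas of a 1-type, so a constant assignment
  evaluates them at \<open>a\<close>.\<close>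

definition realizes :: "('f, 'r, 'a) struct \<Rightarrow> 'a \<Rightarrow> ('f + 'a, 'r) fm set \<Rightarrow> bool" where
  "realizes M a p \<longleftrightarrow> (\<forall>\<phi>\<in>p. sat (name_elements M) (\<lambda>_. a) \<phi>)"

definition one_type ::
  "('f, 'r) language \<Rightarrow> ('f, 'r, 'a) struct \<Rightarrow> 'a set \<Rightarrow> ('f + 'a, 'r) fm set \<Rightarrow> bool" where
  "one_type L M A p \<longleftrightarrow>
     (\<forall>\<phi>\<in>p. wf_fm (add_constants L A) \<phi> \<and> fv \<phi> \<subseteq> {0}) \<and>
     (\<forall>q. finite q \<and> q \<subseteq> p \<longrightarrow> (\<exists>a\<in>univ M. realizes M a q))"

definition card_saturated ::
  "'k rel \<Rightarrow> ('f, 'r) language \<Rightarrow> ('f, 'r, 'a) struct \<Rightarrow> bool" where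
  "card_saturated \<kappa> L M \<longleftrightarrow>
     (\<forall>A p. A \<subseteq> univ M \<and> |A| <o \<kappa> \<and> one_type L M A p \<longrightarrow> (\<exists>a\<in>univ M. realizes M a p))"

definition saturated :: "('f, 'r) language \<Rightarrow> ('f, 'r, 'a) struct \<Rightarrow> bool" where
  "saturated L M \<longleftrightarrow> card_saturated |univ M| L M"

definition ultrafilter :: "'i filter \<Rightarrow> bool" where
  "ultrafilter U \<longleftrightarrow> U \<noteq> bot \<and> (\<forall>P. eventually P U \<or> eventually (\<lambda>i. \<not> P i) U)"

definition nonprincipal_ultrafilter :: "'i filter \<Rightarrow> bool" where
  "nonprincipal_ultrafilter U \<longleftrightarrow> ultrafilter U \<and> (\<forall>i. U \<noteq> principal {i})"

definition ultra_eq ::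
  "'i filter \<Rightarrow> ('i \<Rightarrow> ('f, 'r, 'a) struct) \<Rightarrow> (('i \<Rightarrow> 'a) \<times> ('i \<Rightarrow> 'a)) set" where
  "ultra_eq U \<A> =
     {(x, y). x \<in> (\<Pi> i\<in>UNIV. univ (\<A> i)) \<and> y \<in> (\<Pi> i\<in>UNIV. univ (\<A> i)) \<and>
       (\<forall>\<^sub>F i in U. x i = y i)}"

definition repr :: "('i \<Rightarrow> 'a) set \<Rightarrow> 'i \<Rightarrow> 'a" where
  "repr X = (SOME x. x \<in> X)"

text \<open>Functions and relations are evaluated on chosen representatives; the choice does not
  matter, see \<open>ultraproduct_fun_int\<close> and \<open>ultraproduct_rel_int\<close> below.\<close>

definition ultraproduct ::
  "'i filter \<Rightarrow> ('i \<Rightarrow> ('f, 'r, 'a) struct) \<Rightarrow> ('f, 'r, ('i \<Rightarrow> 'a) set) struct" where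
  "ultraproduct U \<A> =
     \<lparr>univ = (\<Pi> i\<in>UNIV. univ (\<A> i)) // ultra_eq U \<A>,
      fun_int = (\<lambda>f Xs. ultra_eq U \<A> `` {\<lambda>i. fun_int (\<A> i) f (map (\<lambda>X. repr X i) Xs)}),
      rel_int = (\<lambda>r Xs. \<forall>\<^sub>F i in U. rel_int (\<A> i) r (map (\<lambda>X. repr X i) Xs))\<rparr>"

lemma equiv_ultra_eq: "equiv (\<Pi> i\<in>UNIV. univ (\<A> i)) (ultra_eq U \<A>)"
proof (rule equivI)
  show "ultra_eq U \<A> \<subseteq> (\<Pi> i\<in>UNIV. univ (\<A> i)) \<times> (\<Pi> i\<in>UNIV. univ (\<A> i))"
    by (auto simp: ultra_eq_def)
  show "refl_on (\<Pi> i\<in>UNIV. univ (\<A> i)) (ultra_eq U \<A>)"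
    by (auto simp: refl_on_def ultra_eq_def)
  show "sym (ultra_eq U \<A>)"
    by (auto simp: sym_def ultra_eq_def eq_commute)
  show "trans (ultra_eq U \<A>)"
  proof (rule transI)
    fix x y z assume a: "(x, y) \<in> ultra_eq U \<A>" "(y, z) \<in> ultra_eq U \<A>"
    then have "\<forall>\<^sub>F i in U. x i = y i" "\<forall>\<^sub>F i in U. y i = z i" by (auto simp: ultra_eq_def)
    then have "\<forall>\<^sub>F i in U. x i = z i" by eventually_elim simp
    with a show "(x, z) \<in> ultra_eq U \<A>" by (auto simp: ultra_eq_def)
  qed
qed

lemma repr_class:
  assumes "x \<in> (\<Pi> i\<in>UNIV. univ (\<A> i))"
  shows "(x, repr (ultra_eq U \<A> `` {x})) \<in> ultra_eq U \<A>"
proof -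
  have "x \<in> ultra_eq U \<A> `` {x}" using assms by (auto simp: ultra_eq_def)
  then have "repr (ultra_eq U \<A> `` {x}) \<in> ultra_eq U \<A> `` {x}"
    unfolding repr_def by (rule someI[where P = "\<lambda>y. y \<in> ultra_eq U \<A> `` {x}"])
  then show ?thesis by simp
qed

lemma eventually_repr_map:
  assumes "set xs \<subseteq> (\<Pi> i\<in>UNIV. univ (\<A> i))"
  shows "\<forall>\<^sub>F i in U. map (\<lambda>X. repr X i) (map (\<lambda>x. ultra_eq U \<A> `` {x}) xs) = map (\<lambda>x. x i) xs"
  using assms
proof (induction xs)
  case (Cons x xs)
  have "\<forall>\<^sub>F i in U. repr (ultra_eq U \<A> `` {x}) i = x i"
    using repr_class[of x \<A> U] Cons.prems by (auto simp: ultra_eq_def eq_commute)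
  moreover have "\<forall>\<^sub>F i in U. map (\<lambda>X. repr X i) (map (\<lambda>x. ultra_eq U \<A> `` {x}) xs) = map (\<lambda>x. x i) xs"
    using Cons by simp
  ultimately show ?case by eventually_elim simp
qed simp

lemma repr_in:
  assumes "X \<in> (\<Pi> i\<in>UNIV. univ (\<A> i)) // ultra_eq U \<A>"
  shows "repr X i \<in> univ (\<A> i)"
proof -
  obtain x where x: "x \<in> (\<Pi> i\<in>UNIV. univ (\<A> i))" "X = ultra_eq U \<A> `` {x}"
    using assms by (rule quotientE)
  then show ?thesis using repr_class[of x \<A> U] by (auto simp: ultra_eq_def)
qed

lemma ultraproduct_fun_int:
  assumes "\<And>i. is_structure L (\<A> i)" "f \<in> funs L" "length xs = fun_arity L f"
    and "set xs \<subseteq> (\<Pi> i\<in>UNIV. univ (\<A> i))"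
  shows "fun_int (ultraproduct U \<A>) f (map (\<lambda>x. ultra_eq U \<A> `` {x}) xs) =
    ultra_eq U \<A> `` {\<lambda>i. fun_int (\<A> i) f (map (\<lambda>x. x i) xs)}"
proof -
  let ?Xs = "map (\<lambda>x. ultra_eq U \<A> `` {x}) xs"
  have Xs: "X \<in> (\<Pi> i\<in>UNIV. univ (\<A> i)) // ultra_eq U \<A>" if "X \<in> set ?Xs" for X
    using that assms(4) by (auto intro: quotientI)
  have "(\<lambda>i. fun_int (\<A> i) f (map (\<lambda>X. repr X i) ?Xs)) \<in> (\<Pi> i\<in>UNIV. univ (\<A> i))"
  proof (rule Pi_I)
    fix i
    have "set (map (\<lambda>X. repr X i) ?Xs) \<subseteq> univ (\<A> i)" using repr_in[OF Xs] by fastforce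
    moreover have "length (map (\<lambda>X. repr X i) ?Xs) = fun_arity L f" using assms(3) by simp
    ultimately show "fun_int (\<A> i) f (map (\<lambda>X. repr X i) ?Xs) \<in> univ (\<A> i)"
      using assms(1)[of i] assms(2) unfolding is_structure_def by blast
  qed
  moreover have "(\<lambda>i. fun_int (\<A> i) f (map (\<lambda>x. x i) xs)) \<in> (\<Pi> i\<in>UNIV. univ (\<A> i))"
  proof (rule Pi_I)
    fix i
    have "set (map (\<lambda>x. x i) xs) \<subseteq> univ (\<A> i)" using assms(4) by fastforce
    moreover have "length (map (\<lambda>x. x i) xs) = fun_arity L f" using assms(3) by simp
    ultimately show "fun_int (\<A> i) f (map (\<lambda>x. x i) xs) \<in> univ (\<A> i)"
      using assms(1)[of i] assms(2) unfolding is_structure_def by blast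
  qed
  moreover have "\<forall>\<^sub>F i in U. fun_int (\<A> i) f (map (\<lambda>X. repr X i) ?Xs) = fun_int (\<A> i) f (map (\<lambda>x. x i) xs)"
    using eventually_repr_map[OF assms(4), of U] by (rule eventually_mono) (simp only:)
  ultimately have "(\<lambda>i. fun_int (\<A> i) f (map (\<lambda>X. repr X i) ?Xs),
      \<lambda>i. fun_int (\<A> i) f (map (\<lambda>x. x i) xs)) \<in> ultra_eq U \<A>"
    unfolding ultra_eq_def by blast
  then show ?thesis
    using equiv_class_eq[OF equiv_ultra_eq] by (simp add: ultraproduct_def)
qed

lemma ultraproduct_rel_int:
  assumes "set xs \<subseteq> (\<Pi> i\<in>UNIV. univ (\<A> i))"
  shows "rel_int (ultraproduct U \<A>) r (map (\<lambda>x. ultra_eq U \<A> `` {x}) xs) \<longleftrightarrow>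
    (\<forall>\<^sub>F i in U. rel_int (\<A> i) r (map (\<lambda>x. x i) xs))"
proof -
  have "\<forall>\<^sub>F i in U. rel_int (\<A> i) r (map (\<lambda>X. repr X i) (map (\<lambda>x. ultra_eq U \<A> `` {x}) xs)) =
    rel_int (\<A> i) r (map (\<lambda>x. x i) xs)"
    using eventually_repr_map[OF assms, of U] by (rule eventually_mono) (simp only:)
  then show ?thesis unfolding ultraproduct_def struct.simps by (rule eventually_subst)
qed

lemma is_structure_ultraproduct:
  assumes "\<And>i. is_structure L (\<A> i)"
  shows "is_structure L (ultraproduct U \<A>)"
  unfolding is_structure_def
proof (intro conjI ballI allI impI)
  have "(\<lambda>i. SOME a. a \<in> univ (\<A> i)) \<in> (\<Pi> i\<in>UNIV. univ (\<A> i))"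
    using assms by (auto simp: is_structure_def some_in_eq)
  then show "univ (ultraproduct U \<A>) \<noteq> {}"
    by (auto simp: ultraproduct_def quotient_def)
next
  fix f Xs
  assume f: "f \<in> funs L" and "set Xs \<subseteq> univ (ultraproduct U \<A>) \<and> length Xs = fun_arity L f"
  then have Xs: "\<And>X. X \<in> set Xs \<Longrightarrow> X \<in> (\<Pi> i\<in>UNIV. univ (\<A> i)) // ultra_eq U \<A>"
    and len: "length Xs = fun_arity L f" by (auto simp: ultraproduct_def)
  have "(\<lambda>i. fun_int (\<A> i) f (map (\<lambda>X. repr X i) Xs)) \<in> (\<Pi> i\<in>UNIV. univ (\<A> i))"
  proof (rule Pi_I)
    fix i
    have "set (map (\<lambda>X. repr X i) Xs) \<subseteq> univ (\<A> i)" using repr_in[OF Xs] by fastforce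
    moreover have "length (map (\<lambda>X. repr X i) Xs) = fun_arity L f" using len by simp
    ultimately show "fun_int (\<A> i) f (map (\<lambda>X. repr X i) Xs) \<in> univ (\<A> i)"
      using assms[of i] f unfolding is_structure_def by blast
  qed
  then show "fun_int (ultraproduct U \<A>) f Xs \<in> univ (ultraproduct U \<A>)"
    by (simp add: ultraproduct_def quotientI)
qed

text \<open>HOL cannot quantify over types inside a formula, so the symbols of the countable languages
  are natural numbers and the structures of size at most \<open>\<kappa>\<close> live on subsets of the type
  underlying \<open>\<kappa>\<close>. Up to renaming of symbols and isomorphism of structures, these are all
  countable languages and all structures of size at most \<open>\<kappa>\<close>.\<close>

definition SAT :: "'k rel \<Rightarrow> bool" where
  "SAT \<kappa> \<longleftrightarrow>
     (\<exists>U :: nat filter. nonprincipal_ultrafilter U \<and>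
       (\<forall>(L :: (nat, nat) language) (\<A> :: nat \<Rightarrow> (nat, nat, 'k) struct).
          countable_language L \<and> (\<forall>i. is_structure L (\<A> i) \<and> |univ (\<A> i)| \<le>o \<kappa>) \<longrightarrow>
          saturated L (ultraproduct U \<A>)))"

definition is_card_Sup :: "'a rel set \<Rightarrow> 'a rel \<Rightarrow> bool" where
  "is_card_Sup R s \<longleftrightarrow>
     Card_order s \<and> (\<forall>r\<in>R. r \<le>o s) \<and>
     (\<forall>t :: 'a rel. Card_order t \<and> (\<forall>r\<in>R. r \<le>o t) \<longrightarrow> s \<le>o t)"

text \<open>Cardinals are well-orders up to \<open>=o\<close>, so the choice of the supremum is
  immaterial. It exists and is unique by \<open>is_card_Sup_card_Sup\<close> and \<open>is_card_Sup_unique\<close>.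
  Upper bounds on the type \<open>'a\<close> suffice, since every smaller cardinal is represented there.\<close>

definition card_Sup :: "'a rel set \<Rightarrow> 'a rel" where
  "card_Sup R = (SOME s. is_card_Sup R s)"

lemma is_card_Sup_card_Sup:
  fixes R :: "'a rel set"
  assumes "\<And>r. r \<in> R \<Longrightarrow> Card_order r"
  shows "is_card_Sup R (card_Sup R)"
proof -
  let ?B = "{t :: 'a rel. Card_order t \<and> (\<forall>r\<in>R. r \<le>o t)}"
  have "r \<le>o |UNIV :: 'a set|" if "r \<in> R" for r
    by (rule ordIso_ordLeq_trans[OF ordIso_symmetric[OF card_of_Field_ordIso[OF assms[OF that]]]
          card_of_mono1[OF subset_UNIV]])
  then have "|UNIV :: 'a set| \<in> ?B" by (simp add: card_of_Card_order)
  then obtain s where "s \<in> ?B" "\<forall>t\<in>?B. s \<le>o t"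
    using exists_minim_Card_order[of ?B] by blast
  then have "is_card_Sup R s" unfolding is_card_Sup_def by blast
  then show ?thesis unfolding card_Sup_def by (rule someI)
qed

lemma is_card_Sup_unique: "is_card_Sup R s \<Longrightarrow> is_card_Sup R t \<Longrightarrow> s =o t"
  unfolding is_card_Sup_def ordIso_iff_ordLeq by blast

definition two_powers_below :: "'a rel \<Rightarrow> ('a \<Rightarrow> bool) rel" where
  "two_powers_below \<mu> = card_Sup {ctwo ^c \<kappa> |\<kappa> :: 'a rel. Card_order \<kappa> \<and> \<kappa> <o \<mu>}"

definition continuum :: "(nat \<Rightarrow> bool) rel" where
  "continuum = ctwo ^c natLeq"

end

theory Submission
  imports Defs "HOL-Library.Nat_Bijection"
begin

text \<open>Let \<open>M\<close> be the ultrapower of the natural numbers with the Ackermann membership relation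
  \<open>n \<in> set_decode m\<close>. It has size continuum. Every finite set of naturals has a code, so
  coordinatewise every subset of a finite \<open>F \<subseteq> M\<close> is cut out of \<open>F\<close> by some element of \<open>M\<close>.
  Saturation extends this to every \<open>A \<subseteq> M\<close> with \<open>|A| < |M|\<close>. Hence \<open>2\<^bsup>\<kappa>\<^esup> \<le> |M|\<close> whenever
  \<open>\<kappa> < |M|\<close>.\<close>

lemma ultrafilter_neq_bot: "ultrafilter U \<Longrightarrow> U \<noteq> bot"
  by (simp add: ultrafilter_def)

lemma nonprincipal_ultrafilterD: "nonprincipal_ultrafilter U \<Longrightarrow> ultrafilter U"
  by (simp add: nonprincipal_ultrafilter_def)

lemma eventually_not_iff_ultrafilter:
  assumes "ultrafilter U"
  shows "(\<forall>\<^sub>F i in U. \<not> P i) \<longleftrightarrow> \<not> (\<forall>\<^sub>F i in U. P i)"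
proof
  assume not_P: "\<forall>\<^sub>F i in U. \<not> P i"
  show "\<not> (\<forall>\<^sub>F i in U. P i)"
  proof
    assume "\<forall>\<^sub>F i in U. P i"
    with not_P have "\<forall>\<^sub>F i in U. False" by eventually_elim simp
    then show False using ultrafilter_neq_bot[OF assms] by simp
  qed
next
  assume "\<not> (\<forall>\<^sub>F i in U. P i)"
  then show "\<forall>\<^sub>F i in U. \<not> P i" using assms by (auto simp: ultrafilter_def)
qed

lemma nonprincipal_ultrafilter_le_cofinite:
  assumes "nonprincipal_ultrafilter U"
  shows "U \<le> cofinite"
proof (rule filter_leI)
  fix P :: "'a \<Rightarrow> bool"
  assume "eventually P cofinite"
  then have cofinite_P: "finite {i. \<not> P i}" by (simp add: eventually_cofinite)
  note ultra = nonprincipal_ultrafilterD[OF assms]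
  have "\<forall>\<^sub>F i in U. i \<noteq> k" for k
  proof (rule ccontr)
    assume "\<not> (\<forall>\<^sub>F i in U. i \<noteq> k)"
    then have eq_k: "\<forall>\<^sub>F i in U. i = k"
      by (simp add: eventually_not_iff_ultrafilter[OF ultra])
    have "eventually Q U \<longleftrightarrow> Q k" for Q
    proof -
      have "\<forall>\<^sub>F i in U. Q i = Q k" using eq_k by eventually_elim simp
      then have "eventually Q U \<longleftrightarrow> (\<forall>\<^sub>F i in U. Q k)" by (rule eventually_subst)
      then show ?thesis using ultrafilter_neq_bot[OF ultra] by simp
    qed
    then have "U = principal {k}" by (simp add: filter_eq_iff eventually_principal)
    with assms show False by (simp add: nonprincipal_ultrafilter_def)
  qed
  then have "\<forall>\<^sub>F i in U. \<forall>k\<in>{i. \<not> P i}. i \<noteq> k"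
    by (intro eventually_ball_finite[OF cofinite_P]) blast
  then show "eventually P U" by eventually_elim blast
qed

lemma cexp_self_ordLeq:
  assumes "Cinfinite r"
  shows "r ^c r \<le>o ctwo ^c r"
proof -
  have "r ^c r \<le>o (ctwo ^c r) ^c r"
    using assms by (intro cexp_mono1 ordLess_imp_ordLeq ordLess_ctwo_cexp) auto
  also have "(ctwo ^c r) ^c r =o ctwo ^c r"
    using assms
    by (intro cexp_cprod_ordLeq Card_order_ctwo) (auto simp: Cinfinite_Cnotzero ordLeq_refl)
  finally show ?thesis .
qed

lemma continuum_eq_card_of_UNIV: "continuum = |UNIV :: (nat \<Rightarrow> bool) set|"
  by (simp add: continuum_def cexp_def Field_natLeq Field_card_of ctwo_def Func_def)

lemma ordLeq_card_Sup:
  assumes "\<And>r. r \<in> R \<Longrightarrow> Card_order r" and "r \<in> R"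
  shows "r \<le>o card_Sup R"
  using is_card_Sup_card_Sup[of R] assms by (simp add: is_card_Sup_def)

lemma card_Sup_ordLeq:
  fixes R :: "'a rel set" and \<nu> :: "'b rel"
  assumes R: "\<And>r. r \<in> R \<Longrightarrow> Card_order r"
    and \<nu>: "Card_order \<nu>" and bound: "\<And>r. r \<in> R \<Longrightarrow> r \<le>o \<nu>"
  shows "card_Sup R \<le>o \<nu>"
proof (rule ccontr)
  have Sup: "is_card_Sup R (card_Sup R)" by (rule is_card_Sup_card_Sup[OF R])
  assume "\<not> card_Sup R \<le>o \<nu>"
  then have "\<nu> <o card_Sup R"
    using Sup \<nu> not_ordLeq_iff_ordLess[of \<nu> "card_Sup R"]
    by (simp add: is_card_Sup_def card_order_on_well_order_on)
  then obtain \<nu>' :: "'a rel" where \<nu>': "\<nu> =o \<nu>'" "\<nu>' <o card_Sup R"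
    unfolding internalize_ordLess[of \<nu>] by blast
  have "Card_order \<nu>'" by (rule Card_order_ordIso2[OF \<nu> \<nu>'(1)])
  moreover have "\<forall>r\<in>R. r \<le>o \<nu>'" using ordLeq_ordIso_trans[OF bound \<nu>'(1)] by blast
  ultimately have "card_Sup R \<le>o \<nu>'" using Sup by (simp add: is_card_Sup_def)
  with \<nu>'(2) show False using not_ordLess_ordLeq by blast
qed

lemma ctwo_cexp_ordLeq_two_powers_below:
  fixes \<kappa> :: "'b rel" and \<mu> :: "'a rel"
  assumes \<kappa>: "Card_order \<kappa>" "\<kappa> <o \<mu>"
  shows "ctwo ^c \<kappa> \<le>o two_powers_below \<mu>"
proof -
  obtain \<kappa>' :: "'a rel" where \<kappa>': "\<kappa> =o \<kappa>'" "\<kappa>' <o \<mu>"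
    using \<kappa>(2) unfolding internalize_ordLess[of \<kappa>] by blast
  have "ctwo ^c \<kappa> =o ctwo ^c \<kappa>'" by (rule cexp_cong2[OF \<kappa>'(1) Card_order_ctwo \<kappa>(1)])
  also have "ctwo ^c \<kappa>' \<le>o two_powers_below \<mu>"
    unfolding two_powers_below_def
    using Card_order_ordIso2[OF \<kappa>(1) \<kappa>'(1)] \<kappa>'(2)
    by (intro ordLeq_card_Sup) (auto simp: Card_order_cexp)
  finally show ?thesis .
qed

lemma two_powers_below_ordLeq:
  fixes \<mu> :: "'a rel"
  assumes "Card_order \<nu>"
    and "\<And>\<kappa> :: 'a rel. Card_order \<kappa> \<Longrightarrow> \<kappa> <o \<mu> \<Longrightarrow> ctwo ^c \<kappa> \<le>o \<nu>"
  shows "two_powers_below \<mu> \<le>o \<nu>"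
  unfolding two_powers_below_def
  using assms by (intro card_Sup_ordLeq) (auto simp: Card_order_cexp)

lemma univ_ultraproduct:
  "univ (ultraproduct U \<A>) = (\<lambda>x. ultra_eq U \<A> `` {x}) ` (\<Pi> i\<in>UNIV. univ (\<A> i))"
  by (auto simp: ultraproduct_def quotient_def)

lemma ultra_class_eq_iff:
  assumes "x \<in> (\<Pi> i\<in>UNIV. univ (\<A> i))" "y \<in> (\<Pi> i\<in>UNIV. univ (\<A> i))"
  shows "ultra_eq U \<A> `` {x} = ultra_eq U \<A> `` {y} \<longleftrightarrow> (\<forall>\<^sub>F i in U. x i = y i)"
  using eq_equiv_class_iff[OF equiv_ultra_eq assms] assms by (simp add: ultra_eq_def)

lemma repr_in_Pi_univ:
  assumes "X \<in> univ (ultraproduct U \<A>)"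
  shows "repr X \<in> (\<Pi> i\<in>UNIV. univ (\<A> i))"
  using assms repr_in[of X \<A> U] by (auto simp: ultraproduct_def)

lemma ultra_class_repr:
  assumes "X \<in> univ (ultraproduct U \<A>)"
  shows "ultra_eq U \<A> `` {repr X} = X"
proof -
  obtain x where x: "x \<in> (\<Pi> i\<in>UNIV. univ (\<A> i))" "X = ultra_eq U \<A> `` {x}"
    using assms by (auto simp: univ_ultraproduct)
  from equiv_class_eq[OF equiv_ultra_eq repr_class[OF x(1)]] show ?thesis by (simp add: x(2))
qed

lemma eventually_repr_eq_iff:
  assumes "X \<in> univ (ultraproduct U \<A>)" "Y \<in> univ (ultraproduct U \<A>)"
  shows "(\<forall>\<^sub>F i in U. repr X i = repr Y i) \<longleftrightarrow> X = Y"
  using ultra_class_eq_iff[OF assms[THEN repr_in_Pi_univ], of U]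
  by (simp add: assms ultra_class_repr)

lemma eventually_inj_on_repr:
  assumes U: "ultrafilter U" and F: "finite F" "F \<subseteq> univ (ultraproduct U \<A>)"
  shows "\<forall>\<^sub>F i in U. inj_on (\<lambda>X. repr X i) F"
proof -
  have "\<forall>\<^sub>F i in U. repr X i = repr Y i \<longrightarrow> X = Y" if "X \<in> F" "Y \<in> F" for X Y
  proof (cases "X = Y")
    case False
    then have "\<not> (\<forall>\<^sub>F i in U. repr X i = repr Y i)"
      using that F(2) by (simp add: eventually_repr_eq_iff[of X U \<A> Y] subset_iff)
    then have "\<forall>\<^sub>F i in U. repr X i \<noteq> repr Y i"
      by (simp add: eventually_not_iff_ultrafilter[OF U])
    then show ?thesis by eventually_elim simp
  qed simp
  then have "\<forall>\<^sub>F i in U. \<forall>X\<in>F. \<forall>Y\<in>F. repr X i = repr Y i \<longrightarrow> X = Y"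
    by (intro eventually_ball_finite ballI F(1))
  then show ?thesis by (simp add: inj_on_def)
qed

lemma rel_int_ultraproduct_repr:
  assumes X: "X \<in> univ (ultraproduct U \<A>)" and x: "x \<in> (\<Pi> i\<in>UNIV. univ (\<A> i))"
  shows "rel_int (ultraproduct U \<A>) r [X, ultra_eq U \<A> `` {x}] \<longleftrightarrow>
    (\<forall>\<^sub>F i in U. rel_int (\<A> i) r [repr X i, x i])"
proof -
  have "set [repr X, x] \<subseteq> (\<Pi> i\<in>UNIV. univ (\<A> i))" using repr_in_Pi_univ[OF X] x by simp
  from ultraproduct_rel_int[OF this, of U r] show ?thesis
    by (simp only: list.map ultra_class_repr[OF X])
qed

lemma card_of_ultraproduct_ordLeq:
  fixes U :: "'i filter"
  assumes \<kappa>: "Card_order \<kappa>" and size: "\<And>i. |univ (\<A> i)| \<le>o \<kappa>"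
  shows "|univ (ultraproduct U \<A>)| \<le>o \<kappa> ^c |UNIV :: 'i set|"
proof -
  have "\<exists>f. inj_on f (univ (\<A> i)) \<and> f ` univ (\<A> i) \<subseteq> Field \<kappa>" for i
    unfolding card_of_ordLeq
    using size by (rule ordLeq_ordIso_trans) (rule ordIso_symmetric[OF card_of_Field_ordIso[OF \<kappa>]])
  then obtain f where f: "\<And>i. inj_on (f i) (univ (\<A> i))" "\<And>i. f i ` univ (\<A> i) \<subseteq> Field \<kappa>"
    by metis
  have "inj_on (\<lambda>x i. f i (x i)) (\<Pi> i\<in>UNIV. univ (\<A> i))"
  proof (rule inj_onI, rule ext)
    fix x y i
    assume "x \<in> (\<Pi> i\<in>UNIV. univ (\<A> i))" "y \<in> (\<Pi> i\<in>UNIV. univ (\<A> i))"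
      and "(\<lambda>i. f i (x i)) = (\<lambda>i. f i (y i))"
    then show "x i = y i" using inj_onD[OF f(1)] by (metis PiE UNIV_I)
  qed
  moreover have "(\<lambda>x i. f i (x i)) ` (\<Pi> i\<in>UNIV. univ (\<A> i)) \<subseteq> Func UNIV (Field \<kappa>)"
    using f(2) by (fastforce simp: Func_def)
  ultimately have "|\<Pi> i\<in>UNIV. univ (\<A> i)| \<le>o \<kappa> ^c |UNIV :: 'i set|"
    unfolding cexp_def Field_card_of by (intro card_of_ordLeq[THEN iffD1]) blast
  then show ?thesis
    unfolding univ_ultraproduct by (rule ordLeq_transitive[OF card_of_image])
qed

lemma continuum_ordLeq_card_of_ultraproduct:
  fixes \<A> :: "nat \<Rightarrow> ('f, 'r, 'a) struct"
  assumes U: "nonprincipal_ultrafilter U" and inf: "\<And>i. infinite (univ (\<A> i))"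
  shows "continuum \<le>o |univ (ultraproduct U \<A>)|"
proof -
  have "\<exists>e :: nat \<Rightarrow> 'a. inj e \<and> range e \<subseteq> univ (\<A> i)" for i
    by (rule infinite_countable_subset[OF inf])
  then obtain e where e: "\<And>i. inj (e i :: nat \<Rightarrow> 'a)" "\<And>i. range (e i) \<subseteq> univ (\<A> i)" by metis
  define code where "code f i = e i (set_encode {k. k < i \<and> f k})" for f i
  have code: "code f \<in> (\<Pi> i\<in>UNIV. univ (\<A> i))" for f using e(2) by (fastforce simp: code_def)
  have "inj (\<lambda>f. ultra_eq U \<A> `` {code f})"
  proof (rule injI, rule ext)
    fix f g k
    assume "ultra_eq U \<A> `` {code f} = ultra_eq U \<A> `` {code g}"
    then have "\<forall>\<^sub>F i in U. code f i = code g i" by (simp only: ultra_class_eq_iff[OF code code])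
    moreover have "\<forall>\<^sub>F i in U. k < i"
      using nonprincipal_ultrafilter_le_cofinite[OF U] eventually_gt_at_top
      unfolding cofinite_eq_sequentially by (rule filter_leD)
    ultimately have "\<forall>\<^sub>F i in U. f k = g k"
    proof eventually_elim
      case (elim i)
      then have "{j. j < i \<and> f j} = {j. j < i \<and> g j}"
        using e(1) by (simp add: code_def inj_eq set_encode_eq)
      with elim(2) show ?case by blast
    qed
    then show "f k = g k" using ultrafilter_neq_bot[OF nonprincipal_ultrafilterD[OF U]] by simp
  qed
  moreover have "range (\<lambda>f. ultra_eq U \<A> `` {code f}) \<subseteq> univ (ultraproduct U \<A>)"
    using code by (auto simp: univ_ultraproduct)
  ultimately show ?thesis
    unfolding continuum_eq_card_of_UNIV by (intro card_of_ordLeq[THEN iffD1]) blast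
qed

lemma card_of_ultraproduct_denumerable:
  fixes U :: "nat filter"
  assumes U: "nonprincipal_ultrafilter U"
    and size: "\<And>i. |univ (\<A> i)| =o natLeq"
  shows "|univ (ultraproduct U \<A>)| =o continuum"
proof -
  have "|univ (ultraproduct U \<A>)| \<le>o natLeq ^c |UNIV :: nat set|"
    by (rule card_of_ultraproduct_ordLeq[OF natLeq_Card_order ordIso_imp_ordLeq[OF size]])
  also have "natLeq ^c |UNIV :: nat set| =o natLeq ^c natLeq"
    by (rule cexp_cong2[OF card_of_nat natLeq_Card_order card_of_Card_order])
  also have "natLeq ^c natLeq \<le>o continuum"
    unfolding continuum_def by (rule cexp_self_ordLeq[OF natLeq_Cinfinite])
  finally have "|univ (ultraproduct U \<A>)| \<le>o continuum" .
  moreover have "continuum \<le>o |univ (ultraproduct U \<A>)|"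
    using U
  proof (rule continuum_ordLeq_card_of_ultraproduct)
    show "infinite (univ (\<A> i))" for i
      using ordIso_imp_ordLeq[OF ordIso_symmetric[OF size]] infinite_iff_natLeq_ordLeq by blast
  qed
  ultimately show ?thesis by (simp add: ordIso_iff_ordLeq)
qed

text \<open>As in the theory of VC dimension, for the family of sets \<open>{a. rel_int M r [a, x]}\<close>.\<close>

definition shatters :: "('f, 'r, 'a) struct \<Rightarrow> 'r \<Rightarrow> 'a set \<Rightarrow> bool" where
  "shatters M r A \<longleftrightarrow> (\<forall>B\<subseteq>A. \<exists>x\<in>univ M. \<forall>a\<in>A. rel_int M r [a, x] \<longleftrightarrow> a \<in> B)"

definition shatters_finite_sets :: "('f, 'r, 'a) struct \<Rightarrow> 'r \<Rightarrow> bool" where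
  "shatters_finite_sets M r \<longleftrightarrow> (\<forall>F\<subseteq>univ M. finite F \<longrightarrow> shatters M r F)"

lemma card_of_Pow_ordLeq_shatters:
  assumes "shatters M r A"
  shows "|Pow A| \<le>o |univ M|"
proof -
  obtain x where x: "\<And>B. B \<subseteq> A \<Longrightarrow> x B \<in> univ M"
    "\<And>B a. B \<subseteq> A \<Longrightarrow> a \<in> A \<Longrightarrow> rel_int M r [a, x B] \<longleftrightarrow> a \<in> B"
    using assms unfolding shatters_def by metis
  have "inj_on x (Pow A)"
  proof (rule inj_onI)
    fix B C assume "B \<in> Pow A" "C \<in> Pow A" "x B = x C"
    with x(2)[of B] x(2)[of C] show "B = C" by auto
  qed
  with x(1) show ?thesis by (intro card_of_ordLeq[THEN iffD1]) auto
qed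

lemma shatters_imageD:
  assumes "shatters M r (f ` F)" and "B \<subseteq> F"
  shows "\<exists>x\<in>univ M. \<forall>a\<in>F. rel_int M r [f a, x] \<longleftrightarrow> f a \<in> f ` B"
proof -
  have "f ` B \<subseteq> f ` F" using assms(2) by (rule image_mono)
  then have "\<exists>x\<in>univ M. \<forall>b\<in>f ` F. rel_int M r [b, x] \<longleftrightarrow> b \<in> f ` B"
    using assms(1) by (simp only: shatters_def)
  then show ?thesis by (simp only: ball_simps)
qed

lemma shatters_finite_sets_ultraproduct:
  assumes U: "ultrafilter U" and \<A>: "\<And>i. shatters_finite_sets (\<A> i) r"
  shows "shatters_finite_sets (ultraproduct U \<A>) r"
  unfolding shatters_finite_sets_def shatters_def
proof (intro allI impI)
  fix F B
  assume F: "F \<subseteq> univ (ultraproduct U \<A>)" "finite F" and "B \<subseteq> F"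
  have "\<forall>i. \<exists>z\<in>univ (\<A> i).
      \<forall>X\<in>F. rel_int (\<A> i) r [repr X i, z] \<longleftrightarrow> repr X i \<in> (\<lambda>Y. repr Y i) ` B"
  proof
    fix i
    have "(\<lambda>X. repr X i) ` F \<subseteq> univ (\<A> i)" using F(1) repr_in_Pi_univ by fast
    then have "shatters (\<A> i) r ((\<lambda>X. repr X i) ` F)"
      using \<A> \<open>finite F\<close> by (simp add: shatters_finite_sets_def)
    then show "\<exists>z\<in>univ (\<A> i).
        \<forall>X\<in>F. rel_int (\<A> i) r [repr X i, z] \<longleftrightarrow> repr X i \<in> (\<lambda>Y. repr Y i) ` B"
      using \<open>B \<subseteq> F\<close> by (rule shatters_imageD)
  qed
  from choice[OF this[unfolded Bex_def]] obtain x where x: "\<forall>i. x i \<in> univ (\<A> i) \<and>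
      (\<forall>X\<in>F. rel_int (\<A> i) r [repr X i, x i] \<longleftrightarrow> repr X i \<in> (\<lambda>Y. repr Y i) ` B)" ..
  have "rel_int (ultraproduct U \<A>) r [X, ultra_eq U \<A> `` {x}] \<longleftrightarrow> X \<in> B" if "X \<in> F" for X
  proof -
    have "rel_int (ultraproduct U \<A>) r [X, ultra_eq U \<A> `` {x}] \<longleftrightarrow>
        (\<forall>\<^sub>F i in U. rel_int (\<A> i) r [repr X i, x i])"
      using that F(1) x by (intro rel_int_ultraproduct_repr) auto
    also have "\<dots> \<longleftrightarrow> (\<forall>\<^sub>F i in U. X \<in> B)"
    proof (rule eventually_subst)
      show "\<forall>\<^sub>F i in U. rel_int (\<A> i) r [repr X i, x i] = (X \<in> B)"
        using eventually_inj_on_repr[OF U F(2,1)]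
      proof eventually_elim
        case (elim i)
        show ?case using x that inj_on_image_mem_iff[OF elim that \<open>B \<subseteq> F\<close>] by simp
      qed
    qed
    also have "\<dots> \<longleftrightarrow> X \<in> B" using ultrafilter_neq_bot[OF U] by simp
    finally show ?thesis .
  qed
  moreover have "ultra_eq U \<A> `` {x} \<in> univ (ultraproduct U \<A>)"
    using x by (auto simp: univ_ultraproduct)
  ultimately show "\<exists>Z\<in>univ (ultraproduct U \<A>).
      \<forall>X\<in>F. rel_int (ultraproduct U \<A>) r [X, Z] \<longleftrightarrow> X \<in> B"
    by (intro bexI ballI)
qed

definition trace_literal :: "'r \<Rightarrow> 'a set \<Rightarrow> 'a \<Rightarrow> ('f + 'a, 'r) fm" where
  "trace_literal r B a =
     (if a \<in> B then Rel r [App (Inr a) [], Var 0] else Neg (Rel r [App (Inr a) [], Var 0]))"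

lemma sat_trace_literal:
  "sat (name_elements M) (\<lambda>_. x) (trace_literal r B a) \<longleftrightarrow> (rel_int M r [a, x] \<longleftrightarrow> a \<in> B)"
  by (simp add: trace_literal_def name_elements_def)

lemma realizes_trace_literals:
  "realizes M x (trace_literal r B ` A) \<longleftrightarrow> (\<forall>a\<in>A. rel_int M r [a, x] \<longleftrightarrow> a \<in> B)"
  by (simp add: realizes_def sat_trace_literal)

lemma one_type_trace_literals:
  fixes L :: "('f, 'r) language" and M :: "('f, 'r, 'a) struct"
  assumes r: "r \<in> rels L" "rel_arity L r = 2"
    and shatters: "shatters_finite_sets M r" and A: "A \<subseteq> univ M"
  shows "one_type L M A (trace_literal r B ` A)"
  unfolding one_type_def
proof (intro conjI ballI allI impI)
  fix \<phi> :: "('f + 'a, 'r) fm"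
  assume "\<phi> \<in> trace_literal r B ` A"
  then show "wf_fm (add_constants L A) \<phi>" "fv \<phi> \<subseteq> {0}"
    using r by (auto simp: trace_literal_def add_constants_def)
next
  fix q :: "('f + 'a, 'r) fm set"
  assume "finite q \<and> q \<subseteq> trace_literal r B ` A"
  then obtain F where F: "F \<subseteq> A" "finite F" "q = trace_literal r B ` F"
    by (metis finite_subset_image)
  then have "shatters M r F" using shatters A by (auto simp: shatters_finite_sets_def)
  then obtain x where "x \<in> univ M" "\<forall>a\<in>F. rel_int M r [a, x] \<longleftrightarrow> a \<in> F \<inter> B"
    unfolding shatters_def by (meson Int_lower1)
  then show "\<exists>x\<in>univ M. realizes M x q" by (auto simp: F(3) realizes_trace_literals)
qed

lemma shatters_card_saturated:
  assumes sat: "card_saturated \<kappa> L M"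
    and r: "r \<in> rels L" "rel_arity L r = 2" and shatters: "shatters_finite_sets M r"
    and A: "A \<subseteq> univ M" "|A| <o \<kappa>"
  shows "shatters M r A"
  unfolding shatters_def
proof (intro allI impI)
  fix B
  have "\<exists>x\<in>univ M. realizes M x (trace_literal r B ` A)"
    using sat A one_type_trace_literals[OF r shatters A(1), of B]
    unfolding card_saturated_def by blast
  then show "\<exists>x\<in>univ M. \<forall>a\<in>A. rel_int M r [a, x] \<longleftrightarrow> a \<in> B"
    by (simp only: realizes_trace_literals)
qed

lemma ctwo_cexp_ordLeq_saturated:
  fixes \<kappa> :: "'k rel"
  assumes sat: "saturated L M"
    and r: "r \<in> rels L" "rel_arity L r = 2" and shatters: "shatters_finite_sets M r"
    and \<kappa>: "Card_order \<kappa>" "\<kappa> <o |univ M|"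
  shows "ctwo ^c \<kappa> \<le>o |univ M|"
proof -
  have Field_\<kappa>: "|Field \<kappa>| =o \<kappa>" by (rule card_of_Field_ordIso[OF \<kappa>(1)])
  then have "|Field \<kappa>| <o |univ M|" using \<kappa>(2) by (rule ordIso_ordLess_trans)
  then obtain A where A: "A \<subseteq> univ M" "|A| <o |univ M|"
    and Field_A: "|Field \<kappa>| =o |A|"
    unfolding internalize_card_of_ordLess[of "Field \<kappa>"] Field_card_of by blast
  have "\<kappa> =o |A|" by (rule ordIso_transitive[OF ordIso_symmetric[OF Field_\<kappa>] Field_A])
  then have "ctwo ^c \<kappa> =o ctwo ^c |A|" by (rule cexp_cong2[OF _ Card_order_ctwo \<kappa>(1)])
  also have "ctwo ^c |A| =o |Pow A|"
    unfolding cexp_def ctwo_def Field_card_of by (rule ordIso_symmetric[OF card_of_Pow_Func])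
  also have "|Pow A| \<le>o |univ M|"
    using shatters_card_saturated[OF sat[unfolded saturated_def] r shatters A]
    by (rule card_of_Pow_ordLeq_shatters)
  finally show ?thesis .
qed

definition membership_language :: "(nat, nat) language" where
  "membership_language =
     \<lparr>funs = {}, rels = {0}, fun_arity = (\<lambda>_. 0), rel_arity = (\<lambda>_. 2)\<rparr>"

definition ackermann_struct :: "(nat, nat, nat) struct" where
  "ackermann_struct =
     \<lparr>univ = UNIV, fun_int = (\<lambda>_ _. 0), rel_int = (\<lambda>_ xs. xs ! 0 \<in> set_decode (xs ! 1))\<rparr>"

lemma shatters_finite_sets_ackermann_struct: "shatters_finite_sets ackermann_struct r"
  unfolding shatters_finite_sets_def shatters_def
proof (intro allI impI)
  fix F B :: "nat set"
  assume "finite F" "B \<subseteq> F"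
  then have "set_decode (set_encode B) = B" by (metis finite_subset set_encode_inverse)
  then show "\<exists>x\<in>univ ackermann_struct. \<forall>a\<in>F. rel_int ackermann_struct r [a, x] \<longleftrightarrow> a \<in> B"
    by (auto simp: ackermann_struct_def intro!: exI[of _ "set_encode B"])
qed

lemma card_of_ackermann_struct: "|univ ackermann_struct| =o natLeq"
  by (simp add: ackermann_struct_def card_of_nat)

lemma ex_saturated_ackermann_ultrapower:
  assumes "SAT natLeq"
  shows "\<exists>U. nonprincipal_ultrafilter U \<and>
    saturated membership_language (ultraproduct U (\<lambda>_ :: nat. ackermann_struct))"
proof -
  obtain U where U: "nonprincipal_ultrafilter U"
    and sat: "\<And>L (\<A> :: nat \<Rightarrow> (nat, nat, nat) struct). countable_language L \<and>
      (\<forall>i. is_structure L (\<A> i) \<and> |univ (\<A> i)| \<le>o natLeq) \<Longrightarrow> saturated L (ultraproduct U \<A>)"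
    using assms unfolding SAT_def by metis
  have "countable_language membership_language"
    by (simp add: countable_language_def membership_language_def)
  moreover have "is_structure membership_language ackermann_struct"
    by (simp add: is_structure_def membership_language_def ackermann_struct_def)
  ultimately have "saturated membership_language (ultraproduct U (\<lambda>_. ackermann_struct))"
    using ordIso_imp_ordLeq[OF card_of_ackermann_struct] by (intro sat) simp
  with U show ?thesis by (intro exI conjI)
qed

theorem theorem3p5:
  assumes "SAT natLeq"
  shows "two_powers_below continuum =o continuum"
proof -
  obtain U where U: "nonprincipal_ultrafilter U"
    and sat: "saturated membership_language (ultraproduct U (\<lambda>_ :: nat. ackermann_struct))"
    using ex_saturated_ackermann_ultrapower[OF assms] by blast
  let ?M = "ultraproduct U (\<lambda>_. ackermann_struct)"
  have card_M: "|univ ?M| =o continuum"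
    by (rule card_of_ultraproduct_denumerable[OF U card_of_ackermann_struct])
  have shatters: "shatters_finite_sets ?M 0"
    by (intro shatters_finite_sets_ultraproduct nonprincipal_ultrafilterD[OF U]
        shatters_finite_sets_ackermann_struct)
  have "two_powers_below continuum \<le>o |univ ?M|"
  proof (rule two_powers_below_ordLeq[OF card_of_Card_order])
    fix \<kappa> :: "(nat \<Rightarrow> bool) rel" assume "Card_order \<kappa>" "\<kappa> <o continuum"
    then show "ctwo ^c \<kappa> \<le>o |univ ?M|"
      using ordLess_ordIso_trans[OF _ ordIso_symmetric[OF card_M]]
      by (intro ctwo_cexp_ordLeq_saturated[OF sat _ _ shatters])
        (auto simp: membership_language_def)
  qed
  then have "two_powers_below continuum \<le>o continuum" using card_M by (rule ordLeq_ordIso_trans)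
  moreover have "continuum \<le>o two_powers_below continuum"
    using ctwo_cexp_ordLeq_two_powers_below[OF natLeq_Card_order ordLess_ctwo_cexp]
    by (simp add: continuum_def natLeq_Card_order)
  ultimately show ?thesis by (simp add: ordIso_iff_ordLeq)
qed

end
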